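(* Let $G$ be an $n$-cell weighted network and $\mathcal P$ a tagged partition of its set of cells which is not standard. The tagged partition $\mathcal P$ is linear-balanced for $G$ if and only if, for every choice of total phase space $(\mathbb{R}^k)^n$ ($k\ge1$), the generalized polydiagonal $\Delta_{\mathcal P}$ is left invariant under the flow of every system in $I_{G,l}$.
   Context: A weighted network $G$ with set of cells $C=\{1,\ldots,n\}$ is a directed graph with real edge weights. Its adjacency matrix is $W_G=[w_{ij}]\in\mathbb{R}^{n\times n}$, where $w_{ij}$ is the weight of the edge from cell $j$ to cell $i$ (zero if there is no such edge; self-loops allowed). The Laplacian matrix is $L_G=D_G-W_G$, where $D_G$ is the diagonal matrix whose $i$-th diagonal entry is the input valency $v(i)=\sum_{j\in C}w_{ij}$. Tagged partition: let $p,q,r$ be nonnegative integers with $0\le q\le p\le n$, $r\in\{0,1\}$. A tagged partition $\mathcal P$ of $C$ determined by $p,q,r$ is a partition of $C$ into $p+q+r$ disjoint nonempty parts: $P_1,\ldots,P_p$; $\overline P_1,\ldots,\overline P_q$, where $\overline P_l$ is called the counterpart of $P_l$ (and conversely); and, if $r=1$, a part $P_0$ called the zero part. It is standard if $q=0$ and $r=0$. With cell phase space $\mathbb{R}^k$, the generalized polydiagonal associated with $\mathcal P$ is $\Delta_{\mathcal P}=\{x\in(\mathbb{R}^k)^n: x_j=x_i$ if $j$ is in the same part as $i$; $x_j=-x_i$ if $j$ is in the counterpart of the part of $i$; $x_j=0$ if $j\in P_0\}$. A non-standard tagged partition $\mathcal P$ is linear-balanced if $\Delta_{\mathcal P}\subseteq\mathbb{R}^n$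 (the case $k=1$) satisfies $L_G\Delta_{\mathcal P}\subseteq\Delta_{\mathcal P}$. Coupled cell systems with additive input structure: for $k\ge1$, $I_G$ is the set of systems $\dot x=f(x)$ on $(\mathbb{R}^k)^n$ of the form $\dot x_j=g(x_j)+\sum_{i=1}^n w_{ji}h(x_j,x_i)$, $j=1,\ldots,n$, with $g:\mathbb{R}^k\to\mathbb{R}^k$ and $h:\mathbb{R}^k\times\mathbb{R}^k\to\mathbb{R}^k$ smooth. $I_{G,0}\subseteq I_G$ is the subset of those with $h(x,x)=0$ for all $x$. $I_{G,l}\subseteq I_{G,0}$ is the subset of those with moreover $g$ odd and $h$ linear. A subspace $\Delta$ is left invariant under the flow of a system if every solution with initial condition in $\Delta$ remains in $\Delta$ on its interval of existence. *)

theory Defs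
  imports "HOL-Analysis.Analysis" "HOL-Library.Function_Algebras"
begin

section \<open>Weighted networks\<close>

text \<open>
  The cells are the elements of a finite type \<open>'n\<close>, so the number of cells is \<open>CARD('n)\<close>. A weighted
  network is given by its adjacency matrix: \<open>W $ i $ j\<close> is the weight of the edge from \<open>j\<close> to \<open>i\<close>.
\<close>

definition valency :: "real^'n^'n \<Rightarrow> 'n::finite \<Rightarrow> real" where
  "valency W i = (\<Sum>j\<in>UNIV. W $ i $ j)"

definition laplacian :: "real^'n^'n \<Rightarrow> real^'n^'n::finite" where
  "laplacian W = (\<chi> i j. if i = j then valency W i else 0) - W"


section \<open>Tagged partitions and generalized polydiagonals\<close>

datatype tag = Part nat | Counterpart nat | Zero_part

definition tags :: "nat \<Rightarrow> nat \<Rightarrow> nat \<Rightarrow> tag set" where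
  "tags p q r = Part ` {1..p} \<union> Counterpart ` {1..q} \<union> (if r = 1 then {Zero_part} else {})"

text \<open>Only the values of \<open>P\<close> on \<open>tags p q r\<close> matter, here and below.\<close>

definition tagged_partition :: "nat \<Rightarrow> nat \<Rightarrow> nat \<Rightarrow> (tag \<Rightarrow> 'n::finite set) \<Rightarrow> bool" where
  "tagged_partition p q r P \<longleftrightarrow>
     q \<le> p \<and> p \<le> CARD('n) \<and> r \<in> {0, 1} \<and>
     (\<forall>t\<in>tags p q r. P t \<noteq> {}) \<and>
     disjoint_family_on P (tags p q r) \<and>
     (\<Union>t\<in>tags p q r. P t) = UNIV"

definition standard :: "nat \<Rightarrow> nat \<Rightarrow> bool" where
  "standard q r \<longleftrightarrow> q = 0 \<and> r = 0"

text \<open>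
  \<open>V\<close> is the cell phase space. It is a set because the dimension \<open>k\<close> of the cell phase space is
  quantified inside the theorem and hence cannot be encoded in a type.
\<close>

definition polydiagonal ::
  "nat \<Rightarrow> nat \<Rightarrow> nat \<Rightarrow> (tag \<Rightarrow> 'n set) \<Rightarrow> 'v::{zero,uminus} set \<Rightarrow> ('n \<Rightarrow> 'v) set" where
  "polydiagonal p q r P V =
     {x. (\<forall>i. x i \<in> V) \<and>
         (\<forall>t\<in>tags p q r. \<forall>i\<in>P t. \<forall>j\<in>P t. x j = x i) \<and>
         (\<forall>l\<in>{1..q}. \<forall>i\<in>P (Part l). \<forall>j\<in>P (Counterpart l). x j = - x i) \<and>
         (r = 1 \<longrightarrow> (\<forall>j\<in>P Zero_part. x j = 0))}"

definition polydiagonal1 :: "nat \<Rightarrow> nat \<Rightarrow> nat \<Rightarrow> (tag \<Rightarrow> 'n set) \<Rightarrow> (real^'n::finite) set" where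
  "polydiagonal1 p q r P = {x. vec_nth x \<in> polydiagonal p q r P UNIV}"

definition linear_balanced ::
  "real^'n^'n \<Rightarrow> nat \<Rightarrow> nat \<Rightarrow> nat \<Rightarrow> (tag \<Rightarrow> 'n::finite set) \<Rightarrow> bool" where
  "linear_balanced W p q r P \<longleftrightarrow>
     (\<lambda>x. laplacian W *v x) ` polydiagonal1 p q r P \<subseteq> polydiagonal1 p q r P"


section \<open>Smooth maps between the spaces \<open>\<real>\<^sup>d\<close>\<close>

text \<open>
  \<open>\<real>\<^sup>d\<close> is \<^term>\<open>topspace (Euclidean_space d)\<close>, the set of all \<open>x :: nat \<Rightarrow> real\<close> with \<open>x i = 0\<close> for
  all \<open>i \<ge> d\<close>; zero, addition and negation on it are the pointwise ones.
\<close>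

abbreviation Rspace :: "nat \<Rightarrow> (nat \<Rightarrow> real) set" where
  "Rspace d \<equiv> topspace (Euclidean_space d)"

definition partial_deriv :: "nat \<Rightarrow> ((nat \<Rightarrow> real) \<Rightarrow> real) \<Rightarrow> (nat \<Rightarrow> real) \<Rightarrow> real" where
  "partial_deriv i f x = deriv (\<lambda>t. f (x(i := t))) (x i)"

text \<open>\<open>C_diff d m f\<close>: the restriction of \<open>f\<close> to \<open>\<real>\<^sup>d\<close> is of class \<open>C\<^sup>m\<close>.\<close>

primrec C_diff :: "nat \<Rightarrow> nat \<Rightarrow> ((nat \<Rightarrow> real) \<Rightarrow> real) \<Rightarrow> bool" where
  "C_diff d 0 f \<longleftrightarrow> continuous_map (Euclidean_space d) euclideanreal f"
| "C_diff d (Suc m) f \<longleftrightarrow>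
     continuous_map (Euclidean_space d) euclideanreal f \<and>
     (\<forall>i<d. (\<forall>x\<in>Rspace d. (\<lambda>t. f (x(i := t))) differentiable (at (x i))) \<and>
            C_diff d m (partial_deriv i f))"

definition smooth_map :: "nat \<Rightarrow> nat \<Rightarrow> ((nat \<Rightarrow> real) \<Rightarrow> (nat \<Rightarrow> real)) \<Rightarrow> bool" where
  "smooth_map d e f \<longleftrightarrow> f \<in> Rspace d \<rightarrow> Rspace e \<and> (\<forall>a<e. \<forall>m. C_diff d m (\<lambda>x. f x a))"

text \<open>
  Smoothness of a map \<open>\<real>\<^sup>k \<times> \<real>\<^sup>k \<rightarrow> \<real>\<^sup>k\<close>, where \<open>\<real>\<^sup>k \<times> \<real>\<^sup>k\<close> is identified with \<open>\<real>\<^sup>k\<^sup>+\<^sup>k\<close> by concatenation.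
\<close>

definition smooth_map2 :: "nat \<Rightarrow> ((nat \<Rightarrow> real) \<Rightarrow> (nat \<Rightarrow> real) \<Rightarrow> (nat \<Rightarrow> real)) \<Rightarrow> bool" where
  "smooth_map2 k h \<longleftrightarrow>
     smooth_map (k + k) k
       (\<lambda>z. h (\<lambda>a. if a < k then z a else 0) (\<lambda>a. if a < k then z (k + a) else 0))"

definition odd_map :: "nat \<Rightarrow> ((nat \<Rightarrow> real) \<Rightarrow> (nat \<Rightarrow> real)) \<Rightarrow> bool" where
  "odd_map k g \<longleftrightarrow> (\<forall>x\<in>Rspace k. g (- x) = - g x)"

text \<open>Linearity on the product space \<open>\<real>\<^sup>k \<times> \<real>\<^sup>k\<close>, i.e. jointly in both arguments (not bilinearity).\<close>

definition linear_map2 :: "nat \<Rightarrow> ((nat \<Rightarrow> real) \<Rightarrow> (nat \<Rightarrow> real) \<Rightarrow> (nat \<Rightarrow> real)) \<Rightarrow> bool" where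
  "linear_map2 k h \<longleftrightarrow>
     (\<forall>x\<in>Rspace k. \<forall>y\<in>Rspace k. \<forall>x'\<in>Rspace k. \<forall>y'\<in>Rspace k.
        h (x + x') (y + y') = h x y + h x' y') \<and>
     (\<forall>c. \<forall>x\<in>Rspace k. \<forall>y\<in>Rspace k.
        h (\<lambda>a. c * x a) (\<lambda>a. c * y a) = (\<lambda>a. c * h x y a))"


section \<open>Coupled cell systems with additive input structure\<close>

definition additive_field ::
  "real^'n^'n \<Rightarrow> ((nat \<Rightarrow> real) \<Rightarrow> (nat \<Rightarrow> real)) \<Rightarrow> ((nat \<Rightarrow> real) \<Rightarrow> (nat \<Rightarrow> real) \<Rightarrow> (nat \<Rightarrow> real))
   \<Rightarrow> ('n::finite \<Rightarrow> nat \<Rightarrow> real) \<Rightarrow> 'n \<Rightarrow> nat \<Rightarrow> real" where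
  "additive_field W g h x j = (\<lambda>a. g (x j) a + (\<Sum>i\<in>UNIV. W $ j $ i * h (x j) (x i) a))"

text \<open>
  Systems are identified with their vector fields. The sets \<open>I_G\<close>, \<open>I_G0\<close>, \<open>I_Gl\<close> are the images
  under \<open>additive_field W\<close> of the following sets of pairs \<open>(g, h)\<close>.
\<close>

definition pairs_G where
  "pairs_G k = {(g, h). smooth_map k k g \<and> smooth_map2 k h}"

definition pairs_G0 where
  "pairs_G0 k = {(g, h) \<in> pairs_G k. \<forall>x\<in>Rspace k. h x x = 0}"

definition pairs_Gl where
  "pairs_Gl k = {(g, h) \<in> pairs_G0 k. odd_map k g \<and> linear_map2 k h}"

definition I_G :: "real^'n^'n \<Rightarrow> nat \<Rightarrow> (('n::finite \<Rightarrow> nat \<Rightarrow> real) \<Rightarrow> 'n \<Rightarrow> nat \<Rightarrow> real) set" where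
  "I_G W k = (\<lambda>(g, h). additive_field W g h) ` pairs_G k"

definition I_G0 :: "real^'n^'n \<Rightarrow> nat \<Rightarrow> (('n::finite \<Rightarrow> nat \<Rightarrow> real) \<Rightarrow> 'n \<Rightarrow> nat \<Rightarrow> real) set" where
  "I_G0 W k = (\<lambda>(g, h). additive_field W g h) ` pairs_G0 k"

definition I_Gl :: "real^'n^'n \<Rightarrow> nat \<Rightarrow> (('n::finite \<Rightarrow> nat \<Rightarrow> real) \<Rightarrow> 'n \<Rightarrow> nat \<Rightarrow> real) set" where
  "I_Gl W k = (\<lambda>(g, h). additive_field W g h) ` pairs_Gl k"


section \<open>Flow invariance\<close>

text \<open>
  A solution in \<open>(\<real>\<^sup>k)\<^sup>n\<close> on the open interval \<open>J\<close>; the derivative is taken coordinatewise. The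
  coordinates \<open>a \<ge> k\<close> vanish identically.
\<close>

definition solution_on ::
  "nat \<Rightarrow> (('n \<Rightarrow> nat \<Rightarrow> real) \<Rightarrow> 'n \<Rightarrow> nat \<Rightarrow> real) \<Rightarrow> real set \<Rightarrow> (real \<Rightarrow> 'n \<Rightarrow> nat \<Rightarrow> real) \<Rightarrow> bool"
  where
  "solution_on k F J x \<longleftrightarrow>
     open J \<and> is_interval J \<and>
     (\<forall>t\<in>J. \<forall>j. x t j \<in> Rspace k \<and>
        (\<forall>a<k. ((\<lambda>s. x s j a) has_real_derivative F (x t) j a) (at t)))"

text \<open>
  The systems are autonomous, so the initial time is \<open>0\<close>. \<open>J\<close> ranges over all open intervals around
  \<open>0\<close>, in particular over maximal intervals of existence.
\<close>

definition flow_invariant ::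
  "nat \<Rightarrow> (('n \<Rightarrow> nat \<Rightarrow> real) \<Rightarrow> 'n \<Rightarrow> nat \<Rightarrow> real) \<Rightarrow> ('n \<Rightarrow> nat \<Rightarrow> real) set \<Rightarrow> bool" where
  "flow_invariant k F D \<longleftrightarrow>
     (\<forall>J x. solution_on k F J x \<and> 0 \<in> J \<and> x 0 \<in> D \<longrightarrow> (\<forall>t\<in>J. x t \<in> D))"

end

theory Submission
  imports Defs
begin

text \<open>
  Choosing representatives, \<open>\<Delta> = {x. \<forall>i. x i = s i * x (\<rho> i)}\<close> with signs \<open>s i \<in> {0, 1, -1}\<close>. Since
  \<open>h\<close> is linear and vanishes on the diagonal, \<open>h x y = B (x - y)\<close>, so the field of a system in \<open>I_Gl\<close> is
  \<open>g (x j) + B ((L x) j)\<close>. If \<open>L\<close> preserves \<open>\<Delta>\<close>, then the defects \<open>y i = x i - s i * x (\<rho> i)\<close> of a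
  solution satisfy \<open>\<bar>y'\<bar> \<le> C * \<bar>y\<bar>\<close> on compact time intervals, because \<open>g\<close> is odd and locally Lipschitz,
  and Gronwall's inequality gives \<open>y = 0\<close>. Conversely, \<open>k = 1\<close>, \<open>g = 0\<close> and \<open>h x y = x - y\<close> give the
  system \<open>x' = L x\<close>; differentiating its solution through a point of \<open>\<Delta>\<close> at time \<open>0\<close> shows
  \<open>L \<Delta> \<subseteq> \<Delta>\<close>.
\<close>

section \<open>Compactness and Lipschitz estimates on coordinate boxes\<close>

lemma Rspace_iff: "x \<in> Rspace d \<longleftrightarrow> (\<forall>i\<ge>d. x i = 0)"
  by (simp add: topspace_Euclidean_space)

text \<open>By Tychonoff: the box is a product of compact subsets of the real line.\<close>

lemma compactin_box:
  fixes R :: real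
  shows "compactin (Euclidean_space d) {x \<in> Rspace d. \<forall>i. \<bar>x i\<bar> \<le> R}"
proof -
  \<comment> \<open>Intersecting with \<open>{0}\<close>, instead of taking \<open>{0}\<close>
    itself, keeps the product empty for negative \<open>R\<close> even when
    \<open>d = 0\<close>.\<close>
  define S where "S i = (if i < d then {-R..R} else {-R..R} \<inter> {0})" for i
  have "compactin (powertop_real UNIV) (PiE UNIV S)"
    by (auto simp: compactin_PiE S_def)
  moreover have "PiE UNIV S = {x \<in> Rspace d. \<forall>i. \<bar>x i\<bar> \<le> R}"
  proof (intro set_eqI iffI)
    fix x assume "x \<in> PiE UNIV S"
    then have x: "x i \<in> S i" for i by (auto simp: PiE_iff)
    have "\<bar>x i\<bar> \<le> R" "i \<ge> d \<Longrightarrow> x i = 0" for i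
      using x[of i] by (auto simp: S_def split: if_splits)
    then show "x \<in> {x \<in> Rspace d. \<forall>i. \<bar>x i\<bar> \<le> R}" by (simp add: Rspace_iff)
  next
    fix x assume x: "x \<in> {x \<in> Rspace d. \<forall>i. \<bar>x i\<bar> \<le> R}"
    have "x i \<in> S i" for i
    proof -
      have "\<bar>x i\<bar> \<le> R" "i \<ge> d \<Longrightarrow> x i = 0" using x by (auto simp: Rspace_iff)
      then show ?thesis unfolding S_def by (cases "i < d") auto
    qed
    then show "x \<in> PiE UNIV S" by (auto simp: PiE_iff)
  qed
  ultimately show ?thesis
    by (auto simp: Euclidean_space_def compactin_subtopology Rspace_iff)
qed

text \<open>The partial derivatives are continuous, hence bounded on the compact box. Moving from
  \<open>x\<close> to \<open>y\<close> one coordinate at a time stays inside the box, and the mean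
  value inequality bounds each move; this makes the l1 distance the natural one.\<close>

lemma C1_lipschitz_on_box:
  fixes R :: real
  assumes f: "C_diff d (Suc 0) f"
  shows "\<exists>K\<ge>0. \<forall>x\<in>Rspace d. \<forall>y\<in>Rspace d.
    (\<forall>i. \<bar>x i\<bar> \<le> R) \<longrightarrow> (\<forall>i. \<bar>y i\<bar> \<le> R) \<longrightarrow> \<bar>f x - f y\<bar> \<le> K * (\<Sum>b<d. \<bar>x b - y b\<bar>)"
proof -
  define B where "B = {x \<in> Rspace d. \<forall>i. \<bar>x i\<bar> \<le> R}"
  have "\<exists>M. \<forall>x\<in>B. \<bar>partial_deriv i f x\<bar> \<le> M" if "i < d" for i
  proof -
    have "compactin euclideanreal (partial_deriv i f ` B)"
      unfolding B_def by (rule image_compactin[OF compactin_box]) (use f that in auto)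
    then have "bounded (partial_deriv i f ` B)"
      by (simp add: compact_imp_bounded)
    then show ?thesis by (auto simp: bounded_iff)
  qed
  then obtain M where M: "\<And>i x. i < d \<Longrightarrow> x \<in> B \<Longrightarrow> \<bar>partial_deriv i f x\<bar> \<le> M i"
    by metis
  define K where "K = (\<Sum>i<d. \<bar>M i\<bar>)"
  have K: "\<bar>partial_deriv i f x\<bar> \<le> K" if "i < d" "x \<in> B" for i x
  proof -
    have "\<bar>M i\<bar> \<le> K" unfolding K_def using that by (intro member_le_sum) auto
    then show ?thesis using M[OF that] by linarith
  qed
  have K0: "K \<ge> 0" unfolding K_def by (simp add: sum_nonneg)
  \<comment> \<open>Induction on the number \<open>m\<close> of leading coordinates in which
    \<open>x\<close> and \<open>y\<close> may differ. The step replaces \<open>x m\<close> by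
    \<open>y m\<close> and keeps \<open>y\<close> fixed.\<close>
  have "\<bar>f x - f y\<bar> \<le> K * (\<Sum>b<m. \<bar>x b - y b\<bar>)"
    if "m \<le> d" "x \<in> B" "y \<in> B" "\<forall>b\<ge>m. x b = y b" for x y m
    using that
  proof (induction m arbitrary: x)
    case 0
    then have "x = y" by auto
    then show ?case by simp
  next
    case (Suc m)
    have upd: "x(m := t) \<in> B" if "t \<in> {-R..R}" for t
      using Suc.prems that unfolding B_def by (auto simp: Rspace_iff)
    have xm: "x m \<in> {-R..R}" "y m \<in> {-R..R}"
      using Suc.prems by (auto simp: B_def abs_le_iff minus_le_iff)
    have "((\<lambda>s. f (x(m := s))) has_field_derivative partial_deriv m f (x(m := t)))
        (at t within {-R..R})" if "t \<in> {-R..R}" for t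
    proof -
      have "(\<lambda>s. f ((x(m := t))(m := s))) differentiable (at ((x(m := t)) m))"
      proof -
        have "m < d" "x(m := t) \<in> Rspace d"
          using Suc.prems(1) upd[OF that] unfolding B_def by auto
        then show ?thesis using f unfolding C_diff.simps by blast
      qed
      then have "(\<lambda>s. f (x(m := s))) differentiable (at t)" by simp
      then have "((\<lambda>s. f (x(m := s))) has_real_derivative deriv (\<lambda>s. f (x(m := s))) t) (at t)"
        using DERIV_deriv_iff_real_differentiable by blast
      then show ?thesis
        by (simp add: partial_deriv_def has_field_derivative_at_within)
    qed
    then have "norm (f (x(m := x m)) - f (x(m := y m))) \<le> K * norm (x m - y m)"
      using xm upd K Suc.prems(1)
      by (intro field_differentiable_bound[where S = "{-R..R}"
          and f = "\<lambda>s. f (x(m := s))" and f' = "\<lambda>t. partial_deriv m f (x(m := t))"]) auto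
    moreover have "\<bar>f (x(m := y m)) - f y\<bar> \<le> K * (\<Sum>b<m. \<bar>(x(m := y m)) b - y b\<bar>)"
    proof (rule Suc.IH[OF _ upd[OF xm(2)] Suc.prems(3)])
      show "\<forall>b\<ge>m. (x(m := y m)) b = y b"
        using Suc.prems(4) by (metis fun_upd_apply Suc_leI le_neq_implies_less)
    qed (use Suc.prems(1) in simp)
    ultimately show ?case
      by (simp add: algebra_simps)
  qed
  from this[of d] K0 show ?thesis
    by (intro exI[of _ K]) (auto simp: B_def Rspace_iff)
qed

section \<open>Smoothness of constants and coordinate differences\<close>

lemma C_diff_const: "C_diff d m (\<lambda>_. c)"
proof (induction m arbitrary: c)
  case (Suc m)
  have "partial_deriv i (\<lambda>_. c) = (\<lambda>_. 0)" for i
    by (simp add: partial_deriv_def fun_eq_iff)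
  with Suc show ?case by simp
qed simp

lemma continuous_map_Euclidean_component:
  "continuous_map (Euclidean_space d) euclideanreal (\<lambda>x. x i)"
  unfolding Euclidean_space_def
  by (intro continuous_map_from_subtopology continuous_map_product_projection) auto

lemma C_diff_component_diff:
  assumes "i \<noteq> j"
  shows "C_diff d m (\<lambda>x. x i - x j)"
proof (cases m)
  case 0
  then show ?thesis
    by (simp add: continuous_map_diff continuous_map_Euclidean_component)
next
  case (Suc m')
  define c :: "nat \<Rightarrow> real" where "c l = (if l = i then 1 else if l = j then -1 else 0)" for l
  have D: "((\<lambda>t. (x(l := t)) i - (x(l := t)) j) has_real_derivative c l) (at s)" for x :: "nat \<Rightarrow> real" and l s
    using assms by (auto simp: c_def intro!: derivative_eq_intros)
  have "partial_deriv l (\<lambda>x. x i - x j) = (\<lambda>_. c l)" for l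
    unfolding partial_deriv_def fun_eq_iff using DERIV_imp_deriv[OF D] by blast
  moreover have "(\<lambda>t. (x(l := t)) i - (x(l := t)) j) differentiable at s"
    for x :: "nat \<Rightarrow> real" and l s
    unfolding real_differentiable_def using D[of x l s] by blast
  ultimately show ?thesis
    using Suc by (simp add: continuous_map_diff continuous_map_Euclidean_component C_diff_const)
qed

section \<open>The Laplacian and generalized polydiagonals\<close>

text \<open>In this form the Laplacian is the coupling sum of a system with
  \<open>h x y = x - y\<close>.\<close>

lemma laplacian_mult: "(laplacian W *v x) $ j = (\<Sum>i\<in>UNIV. W $ j $ i * (x $ j - x $ i))"
proof -
  have "(laplacian W *v x) $ j
      = (\<Sum>i\<in>UNIV. (if j = i then valency W j * x $ i else 0) - W $ j $ i * x $ i)"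
    unfolding matrix_vector_mult_def laplacian_def
    by (auto simp: algebra_simps intro!: sum.cong)
  also have "\<dots> = valency W j * x $ j - (\<Sum>i\<in>UNIV. W $ j $ i * x $ i)"
    by (simp add: sum_subtractf)
  finally show ?thesis
    by (simp add: valency_def sum_distrib_right right_diff_distrib sum_subtractf)
qed

text \<open>Zero and negation are pointwise on \<open>nat \<Rightarrow> real\<close>, so the
  defining equations split into one copy of the scalar case for each coordinate.\<close>

lemma polydiagonal_componentwise:
  "x \<in> polydiagonal p q r P V \<longleftrightarrow>
    (\<forall>i. x i \<in> V) \<and> (\<forall>a. (\<lambda>i. x i a) \<in> polydiagonal p q r P (UNIV :: real set))"
  unfolding polydiagonal_def mem_Collect_eq fun_eq_iff uminus_apply zero_fun_apply by blast

text \<open>The sign is 1 on parts, -1 on counterparts and 0 on the zero part. The last conjunct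
  makes \<open>x \<mapsto> (\<lambda>i. s i * x (\<rho> i))\<close> a projection onto the
  polydiagonal, so that later proofs need no further properties of \<open>s\<close> and
  \<open>\<rho>\<close>.\<close>

lemma polydiagonal_representatives:
  fixes P :: "tag \<Rightarrow> 'n::finite set"
  assumes "tagged_partition p q r P"
  shows "\<exists>(s :: 'n \<Rightarrow> real) \<rho>. (\<forall>i. s i \<in> {0, 1, -1}) \<and>
    (\<forall>x. x \<in> polydiagonal p q r P (UNIV :: real set) \<longleftrightarrow> (\<forall>i. x i = s i * x (\<rho> i))) \<and>
    (\<forall>x. (\<lambda>i. s i * x (\<rho> i)) \<in> polydiagonal p q r P (UNIV :: real set))"
proof -
  have qp: "q \<le> p" and ne: "\<And>t. t \<in> tags p q r \<Longrightarrow> P t \<noteq> {}"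
    and disj: "\<And>t u i. t \<in> tags p q r \<Longrightarrow> u \<in> tags p q r \<Longrightarrow> i \<in> P t \<Longrightarrow> i \<in> P u \<Longrightarrow> t = u"
    and cov: "\<And>i. \<exists>t\<in>tags p q r. i \<in> P t"
    using assms unfolding tagged_partition_def disjoint_family_on_def by blast+
  obtain T where T: "\<And>i. T i \<in> tags p q r" "\<And>i. i \<in> P (T i)"
    using cov by metis
  have Teq: "T i = t" if "t \<in> tags p q r" "i \<in> P t" for i t
    using disj T that by blast
  define c where "c t = (SOME i. i \<in> P t)" for t
  have c: "c t \<in> P t" if "t \<in> tags p q r" for t
    unfolding c_def using ne[OF that] by (simp add: some_in_eq)
  define s :: "'n \<Rightarrow> real" where
    "s i = (case T i of Part l \<Rightarrow> 1 | Counterpart l \<Rightarrow> -1 | Zero_part \<Rightarrow> 0)" for i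
  \<comment> \<open>A part and its counterpart share one representative, taken from the part. On the
    zero part the choice is arbitrary, since the sign there is 0.\<close>
  define \<rho> where
    "\<rho> i = (case T i of Part l \<Rightarrow> c (Part l) | Counterpart l \<Rightarrow> c (Part l) | Zero_part \<Rightarrow> i)" for i
  have tag_iff: "Part l \<in> tags p q r \<longleftrightarrow> l \<in> {1..p}" "Counterpart l \<in> tags p q r \<longleftrightarrow> l \<in> {1..q}"
    "Zero_part \<in> tags p q r \<longleftrightarrow> r = 1" for l
    unfolding tags_def by auto
  \<comment> \<open>By \<open>q \<le> p\<close>, every counterpart has a part of the same index, so
    its representative exists.\<close>
  have part: "Part l \<in> tags p q r" if "T i = Counterpart l" for i l
    using T(1)[of i] that qp by (auto simp: tag_iff)
  have fwd: "x i = s i * x (\<rho> i)" if x: "x \<in> polydiagonal p q r P (UNIV :: real set)" for x i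
  proof -
    have x_part: "x j = x i" if "t \<in> tags p q r" "i \<in> P t" "j \<in> P t" for t i j
      using x that unfolding polydiagonal_def by blast
    have x_counterpart: "x j = - x i"
      if "l \<in> {1..q}" "i \<in> P (Part l)" "j \<in> P (Counterpart l)" for l i j
      using x that unfolding polydiagonal_def by blast
    have x_zero: "x j = 0" if "r = 1" "j \<in> P Zero_part" for j
      using x that unfolding polydiagonal_def by blast
    show ?thesis
    proof (cases "T i")
      case (Part l)
      then have "Part l \<in> tags p q r" "i \<in> P (Part l)" using T[of i] by simp_all
      then have "x i = x (c (Part l))" using c x_part by blast
      then show ?thesis using Part by (simp add: s_def \<rho>_def)
    next
      case (Counterpart l)
      then have "l \<in> {1..q}" "i \<in> P (Counterpart l)" "c (Part l) \<in> P (Part l)"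
        using T[of i] c part tag_iff by auto
      then have "x i = - x (c (Part l))" using x_counterpart by blast
      then show ?thesis using Counterpart by (simp add: s_def \<rho>_def)
    next
      case Zero_part
      then have "x i = 0" using T[of i] tag_iff x_zero by simp
      then show ?thesis using Zero_part by (simp add: s_def)
    qed
  qed
  have proj: "(\<lambda>i. s i * x (\<rho> i)) \<in> polydiagonal p q r P (UNIV :: real set)" for x
  proof -
    have "s i * x (\<rho> i) = s j * x (\<rho> j)" if "t \<in> tags p q r" "i \<in> P t" "j \<in> P t" for i j t
    proof -
      have "T i = T j" using Teq that by metis
      then show ?thesis by (auto simp: s_def \<rho>_def split: tag.split)
    qed
    moreover have "s j * x (\<rho> j) = - (s i * x (\<rho> i))"
      if "l \<in> {1..q}" "i \<in> P (Part l)" "j \<in> P (Counterpart l)" for i j l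
    proof -
      have "T i = Part l" "T j = Counterpart l" using Teq that qp tag_iff by auto
      then show ?thesis by (simp add: s_def \<rho>_def)
    qed
    moreover have "s j * x (\<rho> j) = 0" if "r = 1" "j \<in> P Zero_part" for j
      using Teq[of Zero_part j] that tag_iff by (simp add: s_def)
    ultimately show ?thesis
      unfolding polydiagonal_def by blast
  qed
  have "x \<in> polydiagonal p q r P (UNIV :: real set) \<longleftrightarrow> (\<forall>i. x i = s i * x (\<rho> i))" for x
  proof
    assume "\<forall>i. x i = s i * x (\<rho> i)"
    then have "x = (\<lambda>i. s i * x (\<rho> i))" by blast
    then show "x \<in> polydiagonal p q r P UNIV" using proj[of x] by argo
  qed (use fwd in blast)
  moreover have "s i \<in> {0, 1, -1}" for i
    by (simp add: s_def split: tag.split)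
  ultimately show ?thesis
    using proj by (intro exI[of _ s] exI[of _ \<rho>]) simp
qed

section \<open>Gronwall's inequality\<close>

text \<open>The function \<open>E t * exp (- M * t)\<close> has derivative
  \<open>(E' t - M * E t) * exp (- M * t) \<le> 0\<close>, so it never exceeds its initial value
  0.\<close>

lemma gronwall_zero_right:
  fixes E :: "real \<Rightarrow> real"
  assumes "0 \<le> T" and "E 0 = 0" and "\<And>t. t \<in> {0..T} \<Longrightarrow> E t \<ge> 0"
    and "\<And>t. t \<in> {0..T} \<Longrightarrow> (E has_real_derivative E' t) (at t)"
    and "\<And>t. t \<in> {0..T} \<Longrightarrow> E' t \<le> M * E t"
  shows "E T = 0"
proof -
  have "E T * exp (- M * T) \<le> E 0 * exp (- M * 0)"
  proof (rule DERIV_nonpos_imp_nonincreasing[OF assms(1)])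
    fix t assume t: "0 \<le> t" "t \<le> T"
    have "((\<lambda>t. E t * exp (- M * t)) has_real_derivative (E' t - M * E t) * exp (- M * t)) (at t)"
      using assms(4)[of t] t by (auto intro!: derivative_eq_intros simp: algebra_simps)
    moreover have "(E' t - M * E t) * exp (- M * t) \<le> 0"
      using assms(5)[of t] t by (intro mult_nonpos_nonneg) auto
    ultimately show "\<exists>y. ((\<lambda>t. E t * exp (- M * t)) has_real_derivative y) (at t) \<and> y \<le> 0"
      by blast
  qed
  then have "E T \<le> 0" using assms(2) by (simp add: mult_le_0_iff)
  with assms(1,3) show ?thesis by force
qed

text \<open>Negative \<open>T\<close> is reduced to the previous case by reversing time. This flips
  the sign of \<open>E'\<close>, which is why its absolute value is bounded.\<close>

lemma gronwall_zero:
  fixes E :: "real \<Rightarrow> real"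
  assumes "E 0 = 0" and "\<And>t. t \<in> closed_segment 0 T \<Longrightarrow> E t \<ge> 0"
    and "\<And>t. t \<in> closed_segment 0 T \<Longrightarrow> (E has_real_derivative E' t) (at t)"
    and "\<And>t. t \<in> closed_segment 0 T \<Longrightarrow> \<bar>E' t\<bar> \<le> M * E t"
  shows "E T = 0"
proof (cases "0 \<le> T")
  case True
  with assms show ?thesis
    by (intro gronwall_zero_right[of T E E' M]) (auto simp: closed_segment_eq_real_ivl abs_le_iff)
next
  case False
  have "E (- (- T)) = 0"
  proof (rule gronwall_zero_right[of "- T" "\<lambda>t. E (- t)" "\<lambda>t. - E' (- t)" M])
    fix t assume t: "t \<in> {0..-T}"
    then have s: "- t \<in> closed_segment 0 T"
      using False by (auto simp: closed_segment_eq_real_ivl)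
    show "((\<lambda>t. E (- t)) has_real_derivative - E' (- t)) (at t)"
      using DERIV_mirror[of E "E' (- t)" t] assms(3)[OF s] by simp
    show "E (- t) \<ge> 0" "- E' (- t) \<le> M * E (- t)"
      using assms(2,4)[OF s] by (auto simp: abs_le_iff)
  qed (use False assms(1) in auto)
  then show ?thesis by simp
qed

text \<open>Gronwall is applied to the sum of squares, which is differentiable where the sum of
  absolute values need not be. Cauchy-Schwarz bounds the squared l1 norm by
  \<open>card I * E t\<close>, whence the constant \<open>2 * C * card I\<close>.\<close>

lemma linear_system_zero:
  fixes y :: "'i \<Rightarrow> real \<Rightarrow> real"
  assumes "finite I" and "0 \<le> C" and "\<And>i. i \<in> I \<Longrightarrow> y i 0 = 0"
    and "\<And>i t. i \<in> I \<Longrightarrow> t \<in> closed_segment 0 T \<Longrightarrow> (y i has_real_derivative y' i t) (at t)"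
    and "\<And>i t. i \<in> I \<Longrightarrow> t \<in> closed_segment 0 T \<Longrightarrow> \<bar>y' i t\<bar> \<le> C * (\<Sum>j\<in>I. \<bar>y j t\<bar>)"
    and "i \<in> I"
  shows "y i T = 0"
proof -
  define E where "E t = (\<Sum>i\<in>I. (y i t)\<^sup>2)" for t
  have "E T = 0"
  proof (rule gronwall_zero[where E = E and T = T and E' = "\<lambda>t. \<Sum>i\<in>I. 2 * y i t * y' i t" 
        and M = "2 * C * card I"])
    fix t assume t: "t \<in> closed_segment 0 T"
    show "(E has_real_derivative (\<Sum>i\<in>I. 2 * y i t * y' i t)) (at t)"
      unfolding E_def using assms(4)[OF _ t]
      by (auto intro!: derivative_eq_intros sum.cong)
    have "\<bar>\<Sum>i\<in>I. 2 * y i t * y' i t\<bar> \<le> (\<Sum>i\<in>I. \<bar>2 * y i t * y' i t\<bar>)"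
      by (rule sum_abs)
    also have "\<dots> \<le> (\<Sum>i\<in>I. 2 * \<bar>y i t\<bar> * (C * (\<Sum>j\<in>I. \<bar>y j t\<bar>)))"
      using assms(5)[OF _ t] by (intro sum_mono) (auto simp: abs_mult intro!: mult_left_mono)
    also have "\<dots> = 2 * C * (\<Sum>j\<in>I. \<bar>y j t\<bar>)\<^sup>2"
      by (simp add: power2_eq_square sum_distrib_left sum_distrib_right mult_ac)
    also have "\<dots> \<le> 2 * C * ((\<Sum>j\<in>I. \<bar>y j t\<bar>\<^sup>2) * card I)"
      using assms(1,2) by (intro mult_left_mono sum_squared_le_sum_of_squares) auto
    finally show "\<bar>\<Sum>i\<in>I. 2 * y i t * y' i t\<bar> \<le> (2 * C * card I) * E t"
      by (simp add: E_def mult_ac)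
  qed (simp_all add: E_def assms(3) sum_nonneg)
  then show ?thesis
    using assms(1,6) by (simp add: E_def sum_nonneg_eq_0_iff)
qed

section \<open>Global solutions of linear differential equations\<close>

text \<open>The solution is the matrix exponential applied to \<open>v\<close>, built entrywise as a
  power series with coefficients \<open>(A^m v)_i / m!\<close>. The exponential series at
  \<open>K * \<bar>t\<bar>\<close> dominates it, so it converges for all times.\<close>

lemma linear_ode_solution:
  fixes A :: "real^'n^'n" and v :: "real^'n"
  obtains x :: "real \<Rightarrow> real^'n"
  where "x 0 = v" and "\<And>t i. ((\<lambda>s. x s $ i) has_real_derivative (A *v x t) $ i) (at t)"
proof -
  define u where "u m = (((*v) A) ^^ m) v" for m
  obtain K where K: "K > 0" "\<And>w. norm (A *v w) \<le> norm w * K"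
    using bounded_linear.pos_bounded[OF matrix_vector_mul_bounded_linear[of A]] by blast
  have u_bound: "norm (u m) \<le> norm v * K ^ m" for m
  proof (induction m)
    case (Suc m)
    have "norm (u (Suc m)) \<le> norm (u m) * K" using K(2) by (simp add: u_def)
    also have "\<dots> \<le> norm v * K ^ m * K" using Suc K by (intro mult_right_mono) auto
    finally show ?case by (simp add: mult_ac)
  qed (simp add: u_def)
  define c where "c i m = u m $ i / fact m" for i m
  have summ: "summable (\<lambda>m. c i m * t ^ m)" for i t
  proof (rule summable_comparison_test')
    show "summable (\<lambda>m. norm v * (inverse (fact m) * (K * \<bar>t\<bar>) ^ m))"
      by (intro summable_mult summable_exp)
    fix m
    have "\<bar>u m $ i\<bar> \<le> norm v * K ^ m"
      using component_le_norm_cart[of "u m" i] u_bound[of m] by linarith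
    then have "\<bar>u m $ i\<bar> * \<bar>t\<bar> ^ m / fact m \<le> norm v * K ^ m * \<bar>t\<bar> ^ m / fact m"
      by (intro divide_right_mono mult_right_mono) auto
    then show "norm (c i m * t ^ m) \<le> norm v * (inverse (fact m) * (K * \<bar>t\<bar>) ^ m)"
      by (simp add: c_def abs_mult power_abs power_mult_distrib field_simps)
  qed
  \<comment> \<open>The differential equation at the level of coefficients: \<open>diffs\<close>
    gives those of the differentiated series.\<close>
  have rec: "diffs (c i) m = (\<Sum>j\<in>UNIV. A $ i $ j * c j m)" for i m
  proof -
    have "diffs (c i) m = (A *v u m) $ i / fact m"
      by (simp add: diffs_def c_def u_def del: of_nat_Suc)
    then show ?thesis
      by (simp add: matrix_vector_mult_def c_def sum_divide_distrib)
  qed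
  define x where "x t = (\<chi> i. \<Sum>m. c i m * t ^ m)" for t
  have "((\<lambda>s. x s $ i) has_real_derivative (A *v x t) $ i) (at t)" for t i
  proof -
    have "(A *v x t) $ i = (\<Sum>j\<in>UNIV. \<Sum>m. A $ i $ j * (c j m * t ^ m))"
      by (simp add: matrix_vector_mult_def x_def suminf_mult summ)
    also have "\<dots> = (\<Sum>m. \<Sum>j\<in>UNIV. A $ i $ j * (c j m * t ^ m))"
      by (intro suminf_sum[symmetric] summable_mult summ)
    also have "\<dots> = (\<Sum>m. diffs (c i) m * t ^ m)"
      by (simp add: rec sum_distrib_right mult.assoc)
    finally show ?thesis
      using termdiffs_strong_converges_everywhere[of "c i" t] summ by (simp add: x_def)
  qed
  moreover have "x 0 = v"
    using powser_zero[of "c _"] by (simp add: x_def vec_eq_iff) (simp add: c_def u_def)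
  ultimately show thesis using that by blast
qed

section \<open>Linear coupling functions\<close>

text \<open>Joint linearity splits \<open>(x, y)\<close> as \<open>(x - y, 0) + (y, y)\<close>, and
  \<open>h\<close> vanishes on the second summand. The coefficients \<open>\<beta>\<close> are the
  matrix of \<open>u \<mapsto> h u 0\<close> in the unit vectors \<open>e b\<close>.\<close>

lemma linear_map2_coefficients:
  assumes lin: "linear_map2 k h" and diag: "\<forall>x\<in>Rspace k. h x x = 0"
  obtains \<beta> :: "nat \<Rightarrow> nat \<Rightarrow> real"
  where "\<And>x y a. x \<in> Rspace k \<Longrightarrow> y \<in> Rspace k \<Longrightarrow> h x y a = (\<Sum>b<k. \<beta> a b * (x b - y b))"
proof -
  define e :: "nat \<Rightarrow> nat \<Rightarrow> real" where "e b = (\<lambda>a. if a = b then 1 else 0)" for b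
  define \<beta> where "\<beta> a b = h (e b) 0 a" for a b
  have add: "h (x + x') (y + y') = h x y + h x' y'"
    if "x \<in> Rspace k" "y \<in> Rspace k" "x' \<in> Rspace k" "y' \<in> Rspace k" for x y x' y'
    using lin that unfolding linear_map2_def by blast
  have scale: "h (\<lambda>a. c * x a) (\<lambda>a. c * y a) = (\<lambda>a. c * h x y a)"
    if "x \<in> Rspace k" "y \<in> Rspace k" for c x y
    using lin that unfolding linear_map2_def by blast
  have z: "0 \<in> Rspace k" by (simp add: Rspace_iff)
  \<comment> \<open>Induction on the number of coordinates that may be nonzero, splitting off the
    last one.\<close>
  have expand: "h u 0 a = (\<Sum>b<m. \<beta> a b * u b)" if "m \<le> k" "u \<in> Rspace m" for u m a
    using that
  proof (induction m arbitrary: u)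
    case 0
    then have "u = 0" by (simp add: Rspace_iff fun_eq_iff)
    then show ?case using diag z by (metis lessThan_0 sum.empty zero_fun_apply)
  next
    case (Suc m)
    let ?u = "u(m := 0)"
    have ek: "e m \<in> Rspace k" "?u \<in> Rspace m" "?u \<in> Rspace k" "(\<lambda>a. u m * e m a) \<in> Rspace k"
      using Suc.prems unfolding Rspace_iff e_def
      by (auto simp: Suc_le_eq)
    have "u = ?u + (\<lambda>a. u m * e m a)" "(0 :: nat \<Rightarrow> real) = 0 + 0"
      by (auto simp: e_def fun_eq_iff)
    then have "h u 0 = h ?u 0 + h (\<lambda>a. u m * e m a) 0"
      using add[OF ek(3) z ek(4) z] by metis
    moreover have "h (\<lambda>a. u m * e m a) 0 = (\<lambda>a. u m * h (e m) 0 a)"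
      using scale[OF ek(1) z, of "u m"] by (simp add: zero_fun_def)
    ultimately have "h u 0 a = h ?u 0 a + u m * \<beta> a m"
      unfolding \<beta>_def by (simp only: plus_fun_apply)
    also have "h ?u 0 a = (\<Sum>b<m. \<beta> a b * ?u b)"
      using Suc.prems(1) by (intro Suc.IH ek(2)) simp
    finally show ?case by (simp add: mult.commute)
  qed
  have "h x y a = (\<Sum>b<k. \<beta> a b * (x b - y b))" if "x \<in> Rspace k" "y \<in> Rspace k" for x y a
  proof -
    have xy: "x - y \<in> Rspace k" using that by (simp add: Rspace_iff)
    have "h x y = h (x - y) 0 + h y y"
      using add[OF xy z that(2) that(2)] by simp
    then show ?thesis using diag that expand[OF _ xy] by simp
  qed
  then show thesis using that by blast
qed

lemma pairs_Gl_difference: "((\<lambda>_. 0), (\<lambda>x y. x - y)) \<in> pairs_Gl 1"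
proof -
  \<comment> \<open>For \<open>k = 1\<close> the arguments of \<open>h\<close> are coordinates 0 and
    1 of the concatenated vector.\<close>
  have "C_diff (Suc (Suc 0)) m (\<lambda>z. z 0 - z (Suc 0))" for m
    by (rule C_diff_component_diff) simp
  then show ?thesis
    by (auto simp: pairs_Gl_def pairs_G0_def pairs_G_def smooth_map_def smooth_map2_def odd_map_def
        linear_map2_def Rspace_iff C_diff_const algebra_simps fun_eq_iff)
qed

section \<open>Flow invariance implies linear balance\<close>

lemma linear_balanced_if_flow_invariant:
  assumes P: "tagged_partition p q r P"
    and inv: "\<forall>F\<in>I_Gl W 1. flow_invariant 1 F (polydiagonal p q r P (Rspace 1))"
  shows "linear_balanced W p q r P"
  unfolding linear_balanced_def
proof (rule image_subsetI)
  fix v assume v: "v \<in> polydiagonal1 p q r P"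
  obtain s \<rho> where poly:
    "\<And>x. x \<in> polydiagonal p q r P (UNIV :: real set) \<longleftrightarrow> (\<forall>i. x i = s i * x (\<rho> i))"
    using polydiagonal_representatives[OF P] by blast
  obtain x where x0: "x 0 = v"
    and x: "\<And>t i. ((\<lambda>s. x s $ i) has_real_derivative (laplacian W *v x t) $ i) (at t)"
    using linear_ode_solution[of v "laplacian W"] by metis
  \<comment> \<open>Transfers the trajectory from \<open>real^'n\<close> to cells with phase space
    \<open>Rspace 1\<close>, where only coordinate 0 may be nonzero.\<close>
  define X where "X t i a = (if a = (0::nat) then x t $ i else 0)" for t i a
  define F where "F = additive_field W (\<lambda>_. 0) (\<lambda>x y. x - y)"
  have "F \<in> I_Gl W 1"
    unfolding I_Gl_def F_def using pairs_Gl_difference by force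
  with inv have "flow_invariant 1 F (polydiagonal p q r P (Rspace 1))" by blast
  moreover have "solution_on 1 F UNIV X"
    using x unfolding solution_on_def
    by (auto simp: F_def additive_field_def X_def Rspace_iff laplacian_mult is_interval_univ)
  moreover have "X 0 \<in> polydiagonal p q r P (Rspace 1)"
  proof -
    have "s i * v $ \<rho> i = v $ i" for i
      using v unfolding polydiagonal1_def mem_Collect_eq poly by metis
    then show ?thesis
      unfolding polydiagonal_componentwise poly by (simp add: X_def Rspace_iff x0)
  qed
  ultimately have X_in: "X t \<in> polydiagonal p q r P (Rspace 1)" for t
    unfolding flow_invariant_def by blast
  have "(\<lambda>i. X t i 0) \<in> polydiagonal p q r P UNIV" for t
    using iffD1[OF polydiagonal_componentwise X_in[of t], THEN conjunct2] by (rule spec)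
  then have "X t i 0 = s i * X t (\<rho> i) 0" for t i
    unfolding poly by (rule spec)
  then have xinv: "x t $ i = s i * x t $ \<rho> i" for t i
    unfolding X_def if_P[OF refl] .
  \<comment> \<open>Since \<open>xinv\<close> holds at all times, both sides are derivatives at 0 of
    the same function.\<close>
  have "(laplacian W *v v) $ i = s i * (laplacian W *v v) $ \<rho> i" for i
  proof (rule DERIV_unique)
    show "((\<lambda>t. x t $ i) has_real_derivative (laplacian W *v v) $ i) (at 0)"
      using x[of i 0] x0 by simp
    show "((\<lambda>t. x t $ i) has_real_derivative s i * (laplacian W *v v) $ \<rho> i) (at 0)"
      unfolding xinv[of _ i] using x[of "\<rho> i" 0] x0 by (intro DERIV_cmult) simp
  qed
  then show "laplacian W *v v \<in> polydiagonal1 p q r P"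
    unfolding polydiagonal1_def mem_Collect_eq poly by blast
qed

section \<open>Linear balance implies flow invariance\<close>

text \<open>The coefficients act on phase space coordinates and the Laplacian on cells, so after
  swapping the sums each coordinate \<open>b\<close> contributes its own Laplacian.\<close>

lemma additive_field_laplacian:
  fixes W :: "real^'n^'n::finite"
  assumes h: "\<And>x y a. x \<in> Rspace k \<Longrightarrow> y \<in> Rspace k \<Longrightarrow> h x y a = (\<Sum>b<k. \<beta> a b * (x b - y b))"
    and x: "\<And>i. x i \<in> Rspace k"
  shows "additive_field W g h x j a
    = g (x j) a + (\<Sum>b<k. \<beta> a b * (laplacian W *v (\<chi> i. x i b)) $ j)"
proof -
  have "(\<Sum>i\<in>UNIV. W $ j $ i * h (x j) (x i) a)
      = (\<Sum>i\<in>UNIV. \<Sum>b<k. \<beta> a b * (W $ j $ i * (x j b - x i b)))"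
    using x by (simp add: h sum_distrib_left mult_ac)
  also have "\<dots> = (\<Sum>b<k. \<beta> a b * (laplacian W *v (\<chi> i. x i b)) $ j)"
    unfolding laplacian_mult by (subst sum.swap) (simp add: sum_distrib_left)
  finally show ?thesis by (simp add: additive_field_def)
qed

text \<open>Oddness handles the sign -1, and also the sign 0 because it forces
  \<open>g 0 = 0\<close>. The defect of \<open>g\<close> thus becomes a difference of two values of
  \<open>g\<close>, to which a Lipschitz bound applies.\<close>

lemma odd_map_scale_sign:
  assumes "odd_map k g" and "s \<in> {0, 1, -1}" and "x \<in> Rspace k"
  shows "s * g x a = g (\<lambda>b. s * x b) a"
proof -
  have "g 0 = - g 0"
    using assms(1) unfolding odd_map_def by (auto simp: Rspace_iff dest: bspec[of _ _ 0])
  then have "g 0 a = - g 0 a" by (metis uminus_apply)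
  moreover have "g (- x) = - g x" using assms(1,3) unfolding odd_map_def by blast
  ultimately show ?thesis
    using assms(2) by (auto simp: zero_fun_def fun_Compl_def)
qed

text \<open>
  The hypothesis \<open>inv\<close> says that \<open>L\<close> maps the image of the projection onto representatives to vectors
  without defect, so the defect of \<open>L u\<close> depends only on the defect of \<open>u\<close>.
\<close>

lemma laplacian_defect_bound:
  fixes W :: "real^'n^'n::finite" and s :: "'n \<Rightarrow> real"
  assumes s: "\<And>i. s i \<in> {0, 1, -1}"
    and inv: "\<And>u j. (laplacian W *v (\<chi> i. s i * u (\<rho> i))) $ j
      = s j * (laplacian W *v (\<chi> i. s i * u (\<rho> i))) $ \<rho> j"
  shows "\<exists>A\<ge>0. \<forall>u j. \<bar>(laplacian W *v (\<chi> i. u i)) $ j - s j * (laplacian W *v (\<chi> i. u i)) $ \<rho> j\<bar>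
      \<le> A * (\<Sum>i\<in>UNIV. \<bar>u i - s i * u (\<rho> i)\<bar>)"
proof -
  obtain K where K: "K > 0" "\<And>w. norm (laplacian W *v w) \<le> norm w * K"
    using bounded_linear.pos_bounded[OF matrix_vector_mul_bounded_linear[of "laplacian W"]] by blast
  \<comment> \<open>The factor 2 counts the two entries of the Laplacian of the defect; the second
    is not enlarged because the sign has absolute value at most 1.\<close>
  have "\<bar>(laplacian W *v (\<chi> i. u i)) $ j - s j * (laplacian W *v (\<chi> i. u i)) $ \<rho> j\<bar>
      \<le> 2 * K * (\<Sum>i\<in>UNIV. \<bar>u i - s i * u (\<rho> i)\<bar>)" for u j
  proof -
    define y where "y = (\<chi> i. u i - s i * u (\<rho> i))"
    have "(\<chi> i. u i) = y + (\<chi> i. s i * u (\<rho> i))"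
      by (simp add: y_def vec_eq_iff)
    then have "(laplacian W *v (\<chi> i. u i)) $ j - s j * (laplacian W *v (\<chi> i. u i)) $ \<rho> j
        = (laplacian W *v y) $ j - s j * (laplacian W *v y) $ \<rho> j"
      using inv[of u j] by (simp add: matrix_vector_right_distrib algebra_simps)
    moreover have "\<bar>(laplacian W *v y) $ i\<bar> \<le> norm y * K" for i
      using component_le_norm_cart[of "laplacian W *v y" i] K(2)[of y] by linarith
    moreover from this have "\<bar>s j * (laplacian W *v y) $ \<rho> j\<bar> \<le> norm y * K"
      using s[of j] K(1) by (auto simp: abs_mult)
    moreover from calculation(2) have "\<bar>(laplacian W *v y) $ j\<bar> \<le> norm y * K" .
    ultimately have "\<bar>(laplacian W *v (\<chi> i. u i)) $ j - s j * (laplacian W *v (\<chi> i. u i)) $ \<rho> j\<bar>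
        \<le> norm y * K + norm y * K"
      by linarith
    also have "\<dots> = 2 * K * norm y" by simp
    also have "\<dots> \<le> 2 * K * (\<Sum>i\<in>UNIV. \<bar>y $ i\<bar>)"
      using K(1) by (intro mult_left_mono norm_le_l1_cart) auto
    finally show ?thesis by (simp add: y_def)
  qed
  with K(1) show ?thesis by (intro exI[of _ "2 * K"]) simp
qed

lemma flow_invariant_if_linear_balanced:
  fixes W :: "real^'n^'n::finite"
  assumes P: "tagged_partition p q r P" and lb: "linear_balanced W p q r P"
    and F: "F \<in> I_Gl W k"
  shows "flow_invariant k F (polydiagonal p q r P (Rspace k))"
proof -
  from F obtain g h where Fgh: "F = additive_field W g h" and g: "smooth_map k k g" "odd_map k g"
    and h: "linear_map2 k h" "\<forall>x\<in>Rspace k. h x x = 0"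
    unfolding I_Gl_def pairs_Gl_def pairs_G0_def pairs_G_def by auto
  obtain \<beta> where \<beta>: "\<And>x y a. x \<in> Rspace k \<Longrightarrow> y \<in> Rspace k \<Longrightarrow>
      h x y a = (\<Sum>b<k. \<beta> a b * (x b - y b))"
    using linear_map2_coefficients[OF h] by blast
  obtain s \<rho> where s: "\<And>i. s i \<in> {0, 1, -1}"
    and poly: "\<And>x. x \<in> polydiagonal p q r P (UNIV :: real set) \<longleftrightarrow> (\<forall>i. x i = s i * x (\<rho> i))"
    and proj: "\<And>x. (\<lambda>i. s i * x (\<rho> i)) \<in> polydiagonal p q r P (UNIV :: real set)"
    using polydiagonal_representatives[OF P] by blast
  define L where "L u j = (laplacian W *v (\<chi> i. u i)) $ j" for u j
  have "(laplacian W *v (\<chi> i. s i * u (\<rho> i))) $ j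
      = s j * (laplacian W *v (\<chi> i. s i * u (\<rho> i))) $ \<rho> j" for u j
  proof -
    have "(\<chi> i. s i * u (\<rho> i)) \<in> polydiagonal1 p q r P"
      using proj[of u] by (simp add: polydiagonal1_def vec_lambda_inverse)
    then have "laplacian W *v (\<chi> i. s i * u (\<rho> i)) \<in> polydiagonal1 p q r P"
      using lb unfolding linear_balanced_def by blast
    then show ?thesis unfolding polydiagonal1_def mem_Collect_eq poly by blast
  qed
  then obtain A where A: "A \<ge> 0"
    "\<And>u j. \<bar>L u j - s j * L u (\<rho> j)\<bar> \<le> A * (\<Sum>i\<in>UNIV. \<bar>u i - s i * u (\<rho> i)\<bar>)"
    unfolding L_def using laplacian_defect_bound[where s = s and \<rho> = \<rho> and W = W] s by blast
  show ?thesis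
    unfolding flow_invariant_def
  proof (intro allI impI ballI, elim conjE)
    fix J x T
    assume sol: "solution_on k F J x" and J0: "0 \<in> J"
      and x0: "x 0 \<in> polydiagonal p q r P (Rspace k)" and T: "T \<in> J"
    have xR: "x t j \<in> Rspace k"
      and dx: "a < k \<Longrightarrow> ((\<lambda>s. x s j a) has_real_derivative F (x t) j a) (at t)"
      if "t \<in> J" for t j a
      using sol that unfolding solution_on_def by blast+
    \<comment> \<open>An interval is convex, so this holds for either sign of
      \<open>T\<close>.\<close>
    have seg: "t \<in> J" if "t \<in> closed_segment 0 T" for t
      using sol J0 T that closed_segment_subset is_interval_convex
      unfolding solution_on_def by blast
    have bounded_x: "\<exists>R. \<forall>t\<in>closed_segment 0 T. \<bar>x t j a\<bar> \<le> R" if "a < k" for j a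
    proof -
      have "continuous_on (closed_segment 0 T) (\<lambda>t. x t j a)"
        by (intro continuous_at_imp_continuous_on ballI DERIV_isCont[OF dx[OF seg that]])
      then have "bounded ((\<lambda>t. x t j a) ` closed_segment 0 T)"
        by (intro compact_imp_bounded compact_continuous_image) auto
      then show ?thesis by (auto simp: bounded_iff)
    qed
    define R0 where "R0 j a = (SOME R. \<forall>t\<in>closed_segment 0 T. \<bar>x t j a\<bar> \<le> R)" for j a
    have R0: "\<bar>x t j a\<bar> \<le> R0 j a" if "a < k" "t \<in> closed_segment 0 T" for j a t
      using someI_ex[OF bounded_x[OF that(1)]] that(2) unfolding R0_def by blast
    \<comment> \<open>One bound for all cells and coordinates on the compact time segment: it fixes
      the box on which \<open>g\<close> is Lipschitz.\<close>
    define R where "R = (\<Sum>j\<in>UNIV. \<Sum>a<k. \<bar>R0 j a\<bar>)"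
    have R: "\<bar>x t j a\<bar> \<le> R" if t: "t \<in> closed_segment 0 T" for t j a
    proof (cases "a < k")
      case True
      have "\<bar>x t j a\<bar> \<le> \<bar>R0 j a\<bar>" using R0[OF True t, of j] by linarith
      also have "\<dots> \<le> (\<Sum>a<k. \<bar>R0 j a\<bar>)" using True by (intro member_le_sum) auto
      also have "\<dots> \<le> R"
        unfolding R_def by (intro member_le_sum[where f = "\<lambda>j. \<Sum>a<k. \<bar>R0 j a\<bar>"]) (auto simp: sum_nonneg)
      finally show ?thesis .
    next
      case False
      moreover have "R \<ge> 0" unfolding R_def by (simp add: sum_nonneg)
      ultimately show ?thesis using xR[OF seg[OF t], of j] by (simp add: Rspace_iff)
    qed
    define lip where "lip a K \<longleftrightarrow> K \<ge> 0 \<and> (\<forall>u\<in>Rspace k. \<forall>v\<in>Rspace k.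
      (\<forall>i. \<bar>u i\<bar> \<le> R) \<longrightarrow> (\<forall>i. \<bar>v i\<bar> \<le> R) \<longrightarrow> \<bar>g u a - g v a\<bar> \<le> K * (\<Sum>b<k. \<bar>u b - v b\<bar>))"
      for a K
    define K where "K a = (SOME K. lip a K)" for a
    have "lip a (K a)" if "a < k" for a
    proof -
      have "C_diff k (Suc 0) (\<lambda>u. g u a)" using g(1) that unfolding smooth_map_def by blast
      then have "\<exists>K. lip a K" unfolding lip_def by (rule C1_lipschitz_on_box[of k _ R])
      then show ?thesis unfolding K_def by (rule someI_ex)
    qed
    then have K: "K a \<ge> 0"
      "u \<in> Rspace k \<Longrightarrow> v \<in> Rspace k \<Longrightarrow> (\<And>i. \<bar>u i\<bar> \<le> R) \<Longrightarrow> (\<And>i. \<bar>v i\<bar> \<le> R) \<Longrightarrow>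
        \<bar>g u a - g v a\<bar> \<le> K a * (\<Sum>b<k. \<bar>u b - v b\<bar>)" if "a < k" for a u v
      using that unfolding lip_def by blast+
    \<comment> \<open>Pairing cells with coordinates turns the defects into a finite scalar system,
      as \<open>linear_system_zero\<close> requires.\<close>
    define I where "I = (UNIV :: 'n set) \<times> {..<k}"
    define y where "y = (\<lambda>(j, a) t. x t j a - s j * x t (\<rho> j) a)"
    define y' where "y' = (\<lambda>(j, a) t. F (x t) j a - s j * F (x t) (\<rho> j) a)"
    \<comment> \<open>For each coordinate, \<open>K a\<close> accounts for \<open>g\<close> and
      \<open>\<bar>\<beta> a b\<bar> * A\<close> for the coupling; summing over \<open>a\<close>
      gives a single constant.\<close>
    define C where "C = (\<Sum>a<k. K a + (\<Sum>b<k. \<bar>\<beta> a b\<bar> * A))"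
    have C_term: "0 \<le> K a + (\<Sum>b<k. \<bar>\<beta> a b\<bar> * A)" if "a < k" for a
      using K(1)[OF that] A(1) by (simp add: sum_nonneg)
    have y_bound: "\<bar>y' (j, a) t\<bar> \<le> C * (\<Sum>i\<in>I. \<bar>y i t\<bar>)"
      if a: "a < k" and t: "t \<in> closed_segment 0 T" for j a t
    proof -
      let ?S = "\<Sum>i\<in>I. \<bar>y i t\<bar>"
      have S0: "?S \<ge> 0" by (simp add: sum_nonneg)
      have xt: "x t i \<in> Rspace k" for i using xR seg t by blast
      let ?G = "g (x t j) a - s j * g (x t (\<rho> j)) a"
      let ?H = "\<lambda>b. L (\<lambda>i. x t i b) j - s j * L (\<lambda>i. x t i b) (\<rho> j)"
      have field: "F (x t) i a = g (x t i) a + (\<Sum>b<k. \<beta> a b * L (\<lambda>i. x t i b) i)" for i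
        unfolding Fgh L_def by (rule additive_field_laplacian[OF \<beta> xt])
      have "y' (j, a) t = ?G + (\<Sum>b<k. \<beta> a b * ?H b)"
        unfolding y'_def by (simp add: field sum_distrib_left sum_subtractf algebra_simps)
      then have "\<bar>y' (j, a) t\<bar> \<le> \<bar>?G\<bar> + (\<Sum>b<k. \<bar>\<beta> a b * ?H b\<bar>)"
        using sum_abs[of "\<lambda>b. \<beta> a b * ?H b" "{..<k}"] by linarith
      moreover have "\<bar>?G\<bar> \<le> K a * ?S"
      proof -
        \<comment> \<open>The state predicted by the representative. It stays in the box because the
          sign has absolute value at most 1, and oddness identifies \<open>g ?v a\<close> with
          \<open>s j * g (x t (\<rho> j)) a\<close>.\<close>
        let ?v = "\<lambda>b. s j * x t (\<rho> j) b"
        have v_le: "\<bar>?v b\<bar> \<le> R" for b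
          using s[of j] R[OF t, of "\<rho> j" b] by (auto simp: abs_mult)
        have v_in: "?v \<in> Rspace k" using xt by (simp add: Rspace_iff)
        have "\<bar>g (x t j) a - g ?v a\<bar> \<le> K a * (\<Sum>b<k. \<bar>x t j b - ?v b\<bar>)"
          by (rule K(2)[OF a xt v_in R[OF t] v_le])
        \<comment> \<open>The estimate for \<open>g\<close> sees only the row of cell
          \<open>j\<close>, and the coupling estimate below only the column of coordinate
          \<open>b\<close>; both are parts of the sum over \<open>I\<close>.\<close>
        also have "(\<Sum>b<k. \<bar>x t j b - ?v b\<bar>) = (\<Sum>i\<in>{j} \<times> {..<k}. \<bar>y i t\<bar>)"
          by (simp add: y_def sum.cartesian_product')
        also have "K a * \<dots> \<le> K a * ?S"
          using K(1)[OF a] unfolding I_def by (intro mult_left_mono sum_mono2) auto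
        finally show ?thesis using odd_map_scale_sign[OF g(2) s xt] by simp
      qed
      moreover have "(\<Sum>b<k. \<bar>\<beta> a b * ?H b\<bar>) \<le> (\<Sum>b<k. \<bar>\<beta> a b\<bar> * A * ?S)"
      proof (rule sum_mono)
        fix b assume b: "b \<in> {..<k}"
        have "\<bar>?H b\<bar> \<le> A * (\<Sum>i\<in>UNIV. \<bar>x t i b - s i * x t (\<rho> i) b\<bar>)"
          by (rule A(2))
        also have "(\<Sum>i\<in>UNIV. \<bar>x t i b - s i * x t (\<rho> i) b\<bar>) = (\<Sum>i\<in>UNIV \<times> {b}. \<bar>y i t\<bar>)"
          by (simp add: y_def sum.cartesian_product')
        also have "A * \<dots> \<le> A * ?S"
          using A(1) b unfolding I_def by (intro mult_left_mono sum_mono2) auto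
        finally show "\<bar>\<beta> a b * ?H b\<bar> \<le> \<bar>\<beta> a b\<bar> * A * ?S"
          by (simp add: abs_mult mult.assoc mult_left_mono)
      qed
      ultimately have "\<bar>y' (j, a) t\<bar> \<le> (K a + (\<Sum>b<k. \<bar>\<beta> a b\<bar> * A)) * ?S"
        by (simp add: distrib_right sum_distrib_right)
      also have "\<dots> \<le> C * ?S"
        unfolding C_def using S0 a C_term
        by (intro mult_right_mono member_le_sum[where f = "\<lambda>a. K a + (\<Sum>b<k. \<bar>\<beta> a b\<bar> * A)"]) auto
      finally show ?thesis .
    qed
    have "C \<ge> 0" unfolding C_def using C_term by (intro sum_nonneg) auto
    moreover have "y i 0 = 0" for i
    proof -
      have "s j * x 0 (\<rho> j) a = x 0 j a" for j a
        using x0 unfolding polydiagonal_componentwise poly by metis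
      then show ?thesis by (cases i) (simp add: y_def)
    qed
    moreover have "(y i has_real_derivative y' i t) (at t)"
      if "i \<in> I" "t \<in> closed_segment 0 T" for i t
      using that dx[OF seg] unfolding I_def y_def y'_def
      by (auto intro!: DERIV_diff DERIV_cmult)
    moreover have "finite I" by (simp add: I_def)
    ultimately have zero: "y i T = 0" if "i \<in> I" for i
      using that y_bound by (intro linear_system_zero[of I C y T y']) (auto simp: I_def)
    have "x T j a = s j * x T (\<rho> j) a" for j a
    proof (cases "a < k")
      case True
      then show ?thesis using zero[of "(j, a)"] by (simp add: I_def y_def)
    next
      case False
      then show ?thesis using xR[OF T] by (simp add: Rspace_iff)
    qed
    then show "x T \<in> polydiagonal p q r P (Rspace k)"
      unfolding polydiagonal_componentwise poly using xR[OF T] by blast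
  qed
qed

theorem proposition9p1:
  fixes W :: "real^'n^'n::finite" and p q r :: nat and P :: "tag \<Rightarrow> 'n set"
  assumes "tagged_partition p q r P" and "\<not> standard q r"
  shows "linear_balanced W p q r P \<longleftrightarrow>
    (\<forall>k\<ge>1. \<forall>F\<in>I_Gl W k. flow_invariant k F (polydiagonal p q r P (Rspace k)))"
proof
  assume "linear_balanced W p q r P"
  then show "\<forall>k\<ge>1. \<forall>F\<in>I_Gl W k. flow_invariant k F (polydiagonal p q r P (Rspace k))"
    by (intro allI impI ballI flow_invariant_if_linear_balanced[OF assms(1)])
next
  assume "\<forall>k\<ge>1. \<forall>F\<in>I_Gl W k. flow_invariant k F (polydiagonal p q r P (Rspace k))"
  then show "linear_balanced W p q r P"
    by (intro linear_balanced_if_flow_invariant[OF assms(1)]) simp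
qed

end
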